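(* Let $\langle E,\circ\rangle$ be a biordered set and let $IG(E)$ be the free idempotent generated semigroup on $E$. Then every periodic element of $IG(E)$ lies in a subgroup of $IG(E)$.
   Context: Biordered sets. The biordered set of a semigroup $S$ is the set of idempotents of $S$ considered as a partial groupoid (a set with a partially defined binary operation) with respect to the restriction of the multiplication of $S$ to exactly those pairs $(e,f)$ of idempotents such that $ef=e$, $ef=f$, $fe=e$ or $fe=f$ (for such pairs the product $ef$ is again an idempotent). A biordered set $\langle E,\circ\rangle$ is a partial groupoid isomorphic to the biordered set of some semigroup. (By a theorem of Easdown this is equivalent to satisfying Nambooripad's axioms for an abstract biordered set.) In particular $e\circ f$ is defined in $E$ if and only if at least one of $e\circ f=e$, $e\circ f=f$, $f\circ e=e$, $f\circ e=f$ holds. Free idempotent generated semigroup. For a biordered set $\langle E,\circ\rangle$, $IG(E)$ is the semigroup given by the presentation with generating set $E$ and defining relations $ef=e\circ f$ for all $e,f\in E$ such that $e\circ f$ is defined in $E$. That is, $IG(E)$ is the quotient of the free semigroup $E^+$ by the congruence generated by all pairs (two-letter word $ef$, one-letter word $e\circ f$) with $e\circ f$ defined. Periodic elements. An element $a$ of a semigroup $S$ is periodic if it generates a finite subsemigroup of $S$; equivalently, $a^h=a^{h+d}$ for some positive integers $h,d$. A subgroup of a semigroup $S$ is a subsemigroup of $S$ that is a group under the multiplication of $S$ (its identity element is some idempotent of $S$). *)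

theory Defs
  imports "HOL-Algebra.Group"
begin

section \<open>Semigroups on a carrier set\<close>

text \<open>The carrier may be empty; in particular a semigroup may have no idempotents.\<close>

definition semigroup_on :: "'a set \<Rightarrow> ('a \<Rightarrow> 'a \<Rightarrow> 'a) \<Rightarrow> bool" where
  "semigroup_on S m \<longleftrightarrow>
     (\<forall>x\<in>S. \<forall>y\<in>S. m x y \<in> S) \<and>
     (\<forall>x\<in>S. \<forall>y\<in>S. \<forall>z\<in>S. m (m x y) z = m x (m y z))"

definition subsemigroup :: "'a set \<Rightarrow> ('a \<Rightarrow> 'a \<Rightarrow> 'a) \<Rightarrow> 'a set \<Rightarrow> bool" where
  "subsemigroup S m T \<longleftrightarrow> T \<subseteq> S \<and> (\<forall>x\<in>T. \<forall>y\<in>T. m x y \<in> T)"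

definition subsemigroup_generated :: "'a set \<Rightarrow> ('a \<Rightarrow> 'a \<Rightarrow> 'a) \<Rightarrow> 'a \<Rightarrow> 'a set" where
  "subsemigroup_generated S m a = \<Inter>{T. subsemigroup S m T \<and> a \<in> T}"

definition periodic :: "'a set \<Rightarrow> ('a \<Rightarrow> 'a \<Rightarrow> 'a) \<Rightarrow> 'a \<Rightarrow> bool" where
  "periodic S m a \<longleftrightarrow> a \<in> S \<and> finite (subsemigroup_generated S m a)"

lemma subsemigroup_generated_powers:
  assumes "semigroup_on S m" "a \<in> S"
  shows "subsemigroup_generated S m a = range (\<lambda>n. (m a ^^ n) a)"
proof
  have pS: "(m a ^^ n) a \<in> S" for n
    using assms by (induction n) (auto simp: semigroup_on_def)
  have add: "m ((m a ^^ i) a) ((m a ^^ j) a) = (m a ^^ Suc (i + j)) a" for i j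
  proof (induction i)
    case (Suc i)
    have "m (m a ((m a ^^ i) a)) ((m a ^^ j) a) = m a (m ((m a ^^ i) a) ((m a ^^ j) a))"
      using assms pS by (auto simp: semigroup_on_def)
    with Suc show ?case by simp
  qed simp
  have "subsemigroup S m (range (\<lambda>n. (m a ^^ n) a))"
    unfolding subsemigroup_def using pS add by blast
  moreover have "a \<in> range (\<lambda>n. (m a ^^ n) a)"
    by (rule range_eqI[of _ _ 0]) simp
  ultimately show "subsemigroup_generated S m a \<subseteq> range (\<lambda>n. (m a ^^ n) a)"
    unfolding subsemigroup_generated_def by blast
  have "(m a ^^ n) a \<in> T" if "subsemigroup S m T" "a \<in> T" for n T
    using that by (induction n) (auto simp: subsemigroup_def)
  then show "range (\<lambda>n. (m a ^^ n) a) \<subseteq> subsemigroup_generated S m a"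
    unfolding subsemigroup_generated_def by blast
qed

definition subgroup_of_semigroup :: "'a set \<Rightarrow> ('a \<Rightarrow> 'a \<Rightarrow> 'a) \<Rightarrow> 'a set \<Rightarrow> bool" where
  "subgroup_of_semigroup S m H \<longleftrightarrow>
     subsemigroup S m H \<and> (\<exists>e. group \<lparr>carrier = H, mult = m, one = e\<rparr>)"


section \<open>Biordered sets\<close>

text \<open>
  A partially defined operation on \<open>E\<close> is a function into the option type, with \<open>None\<close> for
  an undefined product. Only its values at arguments from \<open>E\<close> are relevant.
\<close>

definition partial_groupoid :: "'a set \<Rightarrow> ('a \<Rightarrow> 'a \<Rightarrow> 'a option) \<Rightarrow> bool" where
  "partial_groupoid E p \<longleftrightarrow> (\<forall>e\<in>E. \<forall>f\<in>E. \<forall>g. p e f = Some g \<longrightarrow> g \<in> E)"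

definition partial_groupoid_iso ::
  "'a set \<Rightarrow> ('a \<Rightarrow> 'a \<Rightarrow> 'a option) \<Rightarrow> 'b set \<Rightarrow> ('b \<Rightarrow> 'b \<Rightarrow> 'b option) \<Rightarrow> ('a \<Rightarrow> 'b) \<Rightarrow> bool" where
  "partial_groupoid_iso E p F q \<phi> \<longleftrightarrow>
     bij_betw \<phi> E F \<and> (\<forall>e\<in>E. \<forall>f\<in>E. q (\<phi> e) (\<phi> f) = map_option \<phi> (p e f))"

definition idempotents :: "'a set \<Rightarrow> ('a \<Rightarrow> 'a \<Rightarrow> 'a) \<Rightarrow> 'a set" where
  "idempotents S m = {e \<in> S. m e e = e}"

definition basic_product :: "('a \<Rightarrow> 'a \<Rightarrow> 'a) \<Rightarrow> 'a \<Rightarrow> 'a \<Rightarrow> 'a option" where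
  "basic_product m e f =
     (if m e f = e \<or> m e f = f \<or> m f e = e \<or> m f e = f then Some (m e f) else None)"

text \<open>
  HOL cannot quantify over types inside a formula, so the element type of the witnessing semigroup
  is a parameter. A theorem assuming \<open>biordered_set TYPE('s) E p\<close> for a type variable \<open>'s\<close> covers
  witnesses over every type.
\<close>

definition biordered_set :: "'s itself \<Rightarrow> 'e set \<Rightarrow> ('e \<Rightarrow> 'e \<Rightarrow> 'e option) \<Rightarrow> bool" where
  "biordered_set _ E p \<longleftrightarrow>
     partial_groupoid E p \<and>
     (\<exists>(S :: 's set) m \<phi>. semigroup_on S m \<and>
        partial_groupoid_iso E p (idempotents S m) (basic_product m) \<phi>)"

lemma basic_product_partial_groupoid:
  assumes "semigroup_on S m"
  shows "partial_groupoid (idempotents S m) (basic_product m)"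
proof -
  have "m (m e f) (m e f) = m e f"
    if e: "e \<in> S" "m e e = e" and f: "f \<in> S" "m f f = f"
      and d: "m e f = e \<or> m e f = f \<or> m f e = e \<or> m f e = f" for e f
  proof -
    have cl: "m e f \<in> S" "m f e \<in> S"
      and as: "\<And>x y z. x \<in> S \<Longrightarrow> y \<in> S \<Longrightarrow> z \<in> S \<Longrightarrow> m (m x y) z = m x (m y z)"
      using assms e(1) f(1) by (auto simp: semigroup_on_def)
    have eq: "m (m e f) (m e f) = m e (m (m f e) f)"
      using as e(1) f(1) cl by simp
    from d show ?thesis
      using eq e f as by (metis (full_types))
  qed
  then show ?thesis
    using assms
    by (auto simp: partial_groupoid_def idempotents_def basic_product_def semigroup_on_def
        split: if_splits)
qed


section \<open>Semigroup presentations\<close>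

definition free_semigroup :: "'a set \<Rightarrow> 'a list set" where
  "free_semigroup X = {w. w \<noteq> [] \<and> set w \<subseteq> X}"

inductive_set congruence_generated :: "'a set \<Rightarrow> ('a list \<times> 'a list) set \<Rightarrow> ('a list \<times> 'a list) set"
  for X R where
  base: "(u, v) \<in> R \<Longrightarrow> u \<in> free_semigroup X \<Longrightarrow> v \<in> free_semigroup X \<Longrightarrow>
    (u, v) \<in> congruence_generated X R"
| refl: "u \<in> free_semigroup X \<Longrightarrow> (u, u) \<in> congruence_generated X R"
| sym: "(u, v) \<in> congruence_generated X R \<Longrightarrow> (v, u) \<in> congruence_generated X R"
| trans: "(u, v) \<in> congruence_generated X R \<Longrightarrow> (v, w) \<in> congruence_generated X R \<Longrightarrow>
    (u, w) \<in> congruence_generated X R"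
| append: "(u, v) \<in> congruence_generated X R \<Longrightarrow> (u', v') \<in> congruence_generated X R \<Longrightarrow>
    (u @ u', v @ v') \<in> congruence_generated X R"

definition presented_carrier :: "'a set \<Rightarrow> ('a list \<times> 'a list) set \<Rightarrow> 'a list set set" where
  "presented_carrier X R = free_semigroup X // congruence_generated X R"

definition presented_mult ::
  "'a set \<Rightarrow> ('a list \<times> 'a list) set \<Rightarrow> 'a list set \<Rightarrow> 'a list set \<Rightarrow> 'a list set" where
  "presented_mult X R A B = (\<Union>u\<in>A. \<Union>v\<in>B. congruence_generated X R `` {u @ v})"

lemma congruence_generated_equiv: "equiv (free_semigroup X) (congruence_generated X R)"
proof -
  have "u \<in> free_semigroup X \<and> v \<in> free_semigroup X"
    if "(u, v) \<in> congruence_generated X R" for u v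
    using that by induction (auto simp: free_semigroup_def)
  then show ?thesis
    by (intro equivI refl_onI symI transI)
       (auto intro: congruence_generated.refl congruence_generated.sym congruence_generated.trans)
qed

lemma presented_mult_class:
  assumes "u \<in> free_semigroup X" "v \<in> free_semigroup X"
  shows "presented_mult X R (congruence_generated X R `` {u}) (congruence_generated X R `` {v}) =
    congruence_generated X R `` {u @ v}"
proof -
  let ?C = "congruence_generated X R"
  have "?C `` {u' @ v'} = ?C `` {u @ v}" if "(u, u') \<in> ?C" "(v, v') \<in> ?C" for u' v'
    using equiv_class_eq[OF congruence_generated_equiv congruence_generated.append[OF that]] by simp
  moreover have "(u, u) \<in> ?C" "(v, v) \<in> ?C"
    using assms by (auto intro: congruence_generated.refl)
  ultimately show ?thesis
    unfolding presented_mult_def by blast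
qed

lemma presented_semigroup: "semigroup_on (presented_carrier X R) (presented_mult X R)"
proof -
  have "u @ v \<in> free_semigroup X" if "u \<in> free_semigroup X" "v \<in> free_semigroup X" for u v
    using that by (auto simp: free_semigroup_def)
  then show ?thesis
    unfolding semigroup_on_def presented_carrier_def
    by (auto elim!: quotientE simp: presented_mult_class intro!: quotientI)
qed


section \<open>The free idempotent generated semigroup\<close>

definition IG_relations :: "'e set \<Rightarrow> ('e \<Rightarrow> 'e \<Rightarrow> 'e option) \<Rightarrow> ('e list \<times> 'e list) set" where
  "IG_relations E p = {([e, f], [g]) | e f g. e \<in> E \<and> f \<in> E \<and> p e f = Some g}"

definition IG_carrier :: "'e set \<Rightarrow> ('e \<Rightarrow> 'e \<Rightarrow> 'e option) \<Rightarrow> 'e list set set" where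
  "IG_carrier E p = presented_carrier E (IG_relations E p)"

definition IG_mult ::
  "'e set \<Rightarrow> ('e \<Rightarrow> 'e \<Rightarrow> 'e option) \<Rightarrow> 'e list set \<Rightarrow> 'e list set \<Rightarrow> 'e list set" where
  "IG_mult E p = presented_mult E (IG_relations E p)"

end

theory Submission imports Defs begin

text \<open>
  Call a letter \<open>e\<close> of a word \<open>u = x e y\<close> an \<open>s\<close>-seed if \<open>x e \<in> s S\<^sup>1\<close> and \<open>e y \<in> S\<^sup>1 s\<close> hold
  in \<open>S = IG(E)\<close>. Every defining relation \<open>e f = g\<close> satisfies \<open>e = g e\<close> or \<open>f = f g\<close> in \<open>S\<close>, and
  this makes the existence of an \<open>s\<close>-seed depend only on the element of \<open>S\<close> represented by \<open>u\<close>.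
  If \<open>a\<^sup>h = a\<^sup>h\<^sup>+\<^sup>d\<close> and the word \<open>w\<close> represents \<open>a\<close>, then a power of \<open>w\<close> that is long enough and
  represents \<open>a\<^sup>h\<close> has an \<open>a\<^sup>h\<close>-seed in the middle. Hence so has \<open>w\<^sup>h\<close>. If \<open>h \<ge> 2\<close>, this seed
  avoids the first or the last factor \<open>w\<close>, so that \<open>a\<^sup>h\<^sup>-\<^sup>1 \<in> a\<^sup>h S\<^sup>1 \<union> S\<^sup>1 a\<^sup>h\<close> and therefore
  \<open>a\<^sup>h\<^sup>-\<^sup>1 = a\<^sup>h\<^sup>-\<^sup>1\<^sup>+\<^sup>d\<close>. Descending to \<open>a = a\<^sup>1\<^sup>+\<^sup>d\<close>, the powers of \<open>a\<close> form a group.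
\<close>

section \<open>Seeds of words and their invariance under the generated congruence\<close>

lemma congruence_generated_free:
  assumes "(u, v) \<in> congruence_generated X R"
  shows "u \<in> free_semigroup X" "v \<in> free_semigroup X"
  using equiv_type[OF congruence_generated_equiv[of X R]] assms by auto

lemma congruence_generated_append_left:
  assumes "(u, v) \<in> congruence_generated X R" "set x \<subseteq> X"
  shows "(x @ u, x @ v) \<in> congruence_generated X R"
\<comment> \<open>The rule \<open>append\<close> relates nonempty words only, so an empty
  \<open>x\<close> is treated apart.\<close>
proof (cases "x = []")
  case False
  then have "(x, x) \<in> congruence_generated X R"
    using assms(2) by (auto intro!: congruence_generated.refl simp: free_semigroup_def)
  then show ?thesis
    using assms(1) by (rule congruence_generated.append)
qed (use assms in simp)

lemma congruence_generated_append_right: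
  assumes "(u, v) \<in> congruence_generated X R" "set x \<subseteq> X"
  shows "(u @ x, v @ x) \<in> congruence_generated X R"
proof (cases "x = []")
  case False
  then have "(x, x) \<in> congruence_generated X R"
    using assms(2) by (auto intro!: congruence_generated.refl simp: free_semigroup_def)
  then show ?thesis
    by (rule congruence_generated.append[OF assms(1)])
qed (use assms in simp)

text \<open>The words \<open>x\<close>, \<open>y\<close> and both \<open>t\<close> may be empty. For
  \<open>t\<close> this expresses membership in s S^1 and S^1 s rather than in s S and S s.\<close>

definition seeded :: "'a set \<Rightarrow> ('a list \<times> 'a list) set \<Rightarrow> 'a list \<Rightarrow> 'a list \<Rightarrow> bool" where
  "seeded X R s u \<longleftrightarrow> (\<exists>x e y. u = x @ e # y \<and>
     (\<exists>t. set t \<subseteq> X \<and> (x @ [e], s @ t) \<in> congruence_generated X R) \<and>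
     (\<exists>t. set t \<subseteq> X \<and> (e # y, t @ s) \<in> congruence_generated X R))"

lemma seededI:
  assumes "(x @ [e], s @ t) \<in> congruence_generated X R" "set t \<subseteq> X"
    and "(e # y, t' @ s) \<in> congruence_generated X R" "set t' \<subseteq> X"
  shows "seeded X R s (x @ e # y)"
  using assms unfolding seeded_def by blast

text \<open>This is the property of the presentation of IG(E) on which the seed argument rests. The
  alternatives are stated modulo the congruence: e = g e or f = f g holds in the presented
  semigroup.\<close>

definition one_sided_relations :: "'a set \<Rightarrow> ('a list \<times> 'a list) set \<Rightarrow> bool" where
  "one_sided_relations X R \<longleftrightarrow> (\<forall>(u, v)\<in>R. \<exists>e f g. u = [e, f] \<and> v = [g] \<and>
     (([e], [g, e]) \<in> congruence_generated X R \<or> ([f], [f, g]) \<in> congruence_generated X R))"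

text \<open>Contracting e f to g turns a seed e or f into a seed g: if \<alpha> e is in s S^1, so is
  \<alpha> e f = \<alpha> g, and dually for f. Only the expansion of g to e f depends on
  \<open>side\<close>.\<close>

lemma seeded_contract_iff:
  fixes X R
  defines "C \<equiv> congruence_generated X R"
  assumes ef: "([e, f], [g]) \<in> C" and side: "([e], [g, e]) \<in> C \<or> ([f], [f, g]) \<in> C"
    and ab: "set \<alpha> \<subseteq> X" "set \<beta> \<subseteq> X"
  shows "seeded X R s (\<alpha> @ [e, f] @ \<beta>) \<longleftrightarrow> seeded X R s (\<alpha> @ [g] @ \<beta>)"
proof -
  have letters: "e \<in> X" "f \<in> X" "g \<in> X"
    using congruence_generated_free[OF ef[unfolded C_def]] by (auto simp: free_semigroup_def)
  have ge: "([g], [e, f]) \<in> C"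
    using ef unfolding C_def by (rule congruence_generated.sym)
  have tr: "(u, v) \<in> C \<Longrightarrow> (v, w) \<in> C \<Longrightarrow> (u, w) \<in> C" for u v w
    unfolding C_def by (rule congruence_generated.trans)
  have left: "(u, v) \<in> C \<Longrightarrow> set x \<subseteq> X \<Longrightarrow> (x @ u, x @ v) \<in> C" for u v x
    unfolding C_def by (rule congruence_generated_append_left)
  have right: "(u, v) \<in> C \<Longrightarrow> set x \<subseteq> X \<Longrightarrow> (u @ x, v @ x) \<in> C" for u v x
    unfolding C_def by (rule congruence_generated_append_right)
  have intro: "seeded X R s (x @ c # y)"
    if "(x @ [c], s @ t) \<in> C" "set t \<subseteq> X" "(c # y, t' @ s) \<in> C" "set t' \<subseteq> X" for x c y t t'
    using that unfolding C_def by (rule seededI)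
  \<comment> \<open>For a seed outside the replaced factor, one of the two conditions is literally
    unchanged and the other changes by a congruence. With u and v arbitrary, this serves both
    directions.\<close>
  have outside: "seeded X R s (\<alpha> @ v @ \<beta>)"
    if uv: "(v, u) \<in> C" and eq: "\<alpha> @ u @ \<beta> = x @ c # y"
      and t: "(x @ [c], s @ t) \<in> C" "set t \<subseteq> X" and t': "(c # y, t' @ s) \<in> C" "set t' \<subseteq> X"
      and out: "(\<exists>z. \<alpha> = x @ c # z) \<or> (\<exists>z. \<beta> = z @ c # y)" for u v x c y t t'
    using out
  proof
    assume "\<exists>z. \<alpha> = x @ c # z"
    then obtain z where z: "\<alpha> = x @ c # z" by blast
    then have y: "y = z @ u @ \<beta>" using eq by simp
    have "((c # z) @ v @ \<beta>, (c # z) @ u @ \<beta>) \<in> C"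
      using left[OF right[OF uv ab(2)], of "c # z"] ab z by simp
    then have "(c # z @ v @ \<beta>, t' @ s) \<in> C"
      using tr t'(1) y by simp
    then show ?thesis
      using intro[OF t _ t'(2)] z by simp
  next
    assume "\<exists>z. \<beta> = z @ c # y"
    then obtain z where z: "\<beta> = z @ c # y" by blast
    then have x: "x = \<alpha> @ u @ z" using eq by simp
    have "(\<alpha> @ v @ z @ [c], \<alpha> @ u @ z @ [c]) \<in> C"
      using left[OF right[OF uv, of "z @ [c]"] ab(1)] ab z by simp
    then have "((\<alpha> @ v @ z) @ [c], s @ t) \<in> C"
      using tr t(1) x by simp
    then show ?thesis
      using intro[of "\<alpha> @ v @ z" c t y t'] t t' z by simp
  qed
  show ?thesis
  proof
    assume "seeded X R s (\<alpha> @ [e, f] @ \<beta>)"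
    then obtain x c y t t' where eq: "\<alpha> @ [e, f] @ \<beta> = x @ c # y"
      and t: "(x @ [c], s @ t) \<in> C" "set t \<subseteq> X" and t': "(c # y, t' @ s) \<in> C" "set t' \<subseteq> X"
      unfolding seeded_def C_def by blast
    from eq consider "\<exists>z. \<alpha> = x @ c # z" | "\<exists>z. \<beta> = z @ c # y"
      | "x = \<alpha>" "c = e" "y = f # \<beta>" | "x = \<alpha> @ [e]" "c = f" "y = \<beta>"
      by (auto simp: append_eq_append_conv2 append_eq_Cons_conv Cons_eq_append_conv)
    then show "seeded X R s (\<alpha> @ [g] @ \<beta>)"
    proof cases
      case 3
      have "(\<alpha> @ [g], \<alpha> @ [e, f]) \<in> C"
        using left[OF ge ab(1)] .
      moreover have "(\<alpha> @ [e, f], s @ t @ [f]) \<in> C"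
        using right[OF t(1), of "[f]"] 3 letters by simp
      ultimately have "(\<alpha> @ [g], s @ t @ [f]) \<in> C"
        by (rule tr)
      moreover have "(g # \<beta>, t' @ s) \<in> C"
        using tr[OF right[OF ge ab(2)]] t'(1) 3 by simp
      ultimately show ?thesis
        using intro[of \<alpha> g "t @ [f]" \<beta> t'] t t' letters by simp
    next
      case 4
      have "(g # \<beta>, e # f # \<beta>) \<in> C"
        using right[OF ge ab(2)] by simp
      moreover have "(e # f # \<beta>, (e # t') @ s) \<in> C"
        using left[OF t'(1), of "[e]"] 4 letters by simp
      ultimately have "(g # \<beta>, (e # t') @ s) \<in> C"
        by (rule tr)
      moreover have "(\<alpha> @ [g], s @ t) \<in> C"
        using tr[OF left[OF ge ab(1)]] t(1) 4 by simp
      ultimately show ?thesis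
        using intro[of \<alpha> g t \<beta> "e # t'"] t t' letters by simp
    qed (use outside[OF ge eq t t'] in blast)+
  next
    assume "seeded X R s (\<alpha> @ [g] @ \<beta>)"
    then obtain x c y t t' where eq: "\<alpha> @ [g] @ \<beta> = x @ c # y"
      and t: "(x @ [c], s @ t) \<in> C" "set t \<subseteq> X" and t': "(c # y, t' @ s) \<in> C" "set t' \<subseteq> X"
      unfolding seeded_def C_def by blast
    from eq consider "\<exists>z. \<alpha> = x @ c # z" | "\<exists>z. \<beta> = z @ c # y" | "x = \<alpha>" "c = g" "y = \<beta>"
      by (auto simp: append_eq_append_conv2 append_eq_Cons_conv Cons_eq_append_conv)
    then show "seeded X R s (\<alpha> @ [e, f] @ \<beta>)"
    proof cases
      case 3
      \<comment> \<open>The seed g passes to the letter that absorbs it. If e = g e, then \<alpha> e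
        = \<alpha> g e stays in s S^1, while e f \<beta> = g \<beta>. If f = f g, the dual argument
        makes f a seed.\<close>
      from side show ?thesis
      proof
        assume "([e], [g, e]) \<in> C"
        then have "(\<alpha> @ [e], \<alpha> @ [g, e]) \<in> C"
          using left ab(1) by blast
        moreover have "(\<alpha> @ [g, e], s @ t @ [e]) \<in> C"
          using right[OF t(1), of "[e]"] 3 letters by simp
        ultimately have "(\<alpha> @ [e], s @ t @ [e]) \<in> C"
          by (rule tr)
        moreover have "(e # f # \<beta>, t' @ s) \<in> C"
          using tr[OF right[OF ef ab(2)]] t'(1) 3 by simp
        ultimately show ?thesis
          using intro[of \<alpha> e "t @ [e]" "f # \<beta>" t'] t t' letters by simp
      next
        assume "([f], [f, g]) \<in> C"
        then have "(f # \<beta>, f # g # \<beta>) \<in> C"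
          using right[of "[f]" "[f, g]" \<beta>] ab(2) by simp
        moreover have "(f # g # \<beta>, (f # t') @ s) \<in> C"
          using left[OF t'(1), of "[f]"] 3 letters by simp
        ultimately have "(f # \<beta>, (f # t') @ s) \<in> C"
          by (rule tr)
        moreover have "((\<alpha> @ [e]) @ [f], s @ t) \<in> C"
          using tr[OF left[OF ef ab(1)]] t(1) 3 by simp
        ultimately show ?thesis
          using intro[of "\<alpha> @ [e]" f t \<beta> "f # t'"] t t' letters by simp
      qed
    qed (use outside[OF ef eq t t'] in blast)+
  qed
qed

text \<open>The contexts \<alpha> and \<beta> carry the induction through \<open>append\<close>:
  first u is replaced in the context \<alpha>, u' \<beta>, then u' in the context \<alpha> v,
  \<beta>.\<close>

lemma seeded_cong:
  assumes R: "one_sided_relations X R"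
    and "(u, v) \<in> congruence_generated X R" "set \<alpha> \<subseteq> X" "set \<beta> \<subseteq> X"
  shows "seeded X R s (\<alpha> @ u @ \<beta>) \<longleftrightarrow> seeded X R s (\<alpha> @ v @ \<beta>)"
  using assms(2-)
proof (induction arbitrary: \<alpha> \<beta>)
  case (base u v)
  from base(1) R obtain e f g where "u = [e, f]" "v = [g]"
    "([e], [g, e]) \<in> congruence_generated X R \<or> ([f], [f, g]) \<in> congruence_generated X R"
    unfolding one_sided_relations_def by fast
  moreover have "(u, v) \<in> congruence_generated X R"
    using base by (intro congruence_generated.base)
  ultimately show ?case
    using seeded_contract_iff base.prems by metis
next
  case (append u v u' v')
  have "set u' \<subseteq> X" "set v \<subseteq> X"
    using congruence_generated_free(1)[OF append.hyps(2)] congruence_generated_free(2)[OF append.hyps(1)]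
    by (simp_all add: free_semigroup_def)
  then show ?case
    using append.IH(1)[of \<alpha> "u' @ \<beta>"] append.IH(2)[of "\<alpha> @ v" \<beta>] append.prems by simp
qed auto

section \<open>Powers of words\<close>

definition word_power :: "'a list \<Rightarrow> nat \<Rightarrow> 'a list" where
  "word_power w n = concat (replicate n w)"

lemma word_power_simps [simp]:
  "word_power w 0 = []" "word_power w (Suc n) = w @ word_power w n"
  by (simp_all add: word_power_def)

lemma word_power_add: "word_power w (i + j) = word_power w i @ word_power w j"
  by (simp add: word_power_def replicate_add)

lemma set_word_power: "set w \<subseteq> X \<Longrightarrow> set (word_power w n) \<subseteq> X"
  by (auto simp: word_power_def)

lemma word_power_free:
  "w \<in> free_semigroup X \<Longrightarrow> n > 0 \<Longrightarrow> word_power w n \<in> free_semigroup X"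
  using set_word_power[of w X n] by (cases n) (auto simp: free_semigroup_def)

text \<open>Here \<open>k\<close> numbers, from 0, the factor \<open>w\<close> containing the marked
  letter. The descent uses it to find a factor that the seed avoids.\<close>

lemma word_power_eq_append_Cons:
  assumes "word_power w n = x @ e # y"
  obtains k w' w'' where "k < n" "w = w' @ e # w''"
    "x = word_power w k @ w'" "y = w'' @ word_power w (n - Suc k)"
  using assms
proof (induction n arbitrary: x thesis)
  case (Suc n)
  from Suc.prems(2) consider z where "w = x @ e # z" "y = z @ word_power w n"
    | z where "x = w @ z" "word_power w n = z @ e # y"
    by (auto simp: append_eq_append_conv2 append_eq_Cons_conv Cons_eq_append_conv)
  then show ?case
  proof cases
    case 1
    then show ?thesis using Suc.prems(1)[of 0 x z] by simp
  next
    case 2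
    obtain k w' w'' where "k < n" "w = w' @ e # w''"
      "z = word_power w k @ w'" "y = w'' @ word_power w (n - Suc k)"
      using Suc.IH[OF _ 2(2)] by blast
    then show ?thesis using 2(1) Suc.prems(1)[of "Suc k" w' w''] by simp
  qed
qed simp

section \<open>Periodic powers: existence of seeds and descent of the exponent\<close>

lemma word_power_period:
  assumes "set w \<subseteq> X" "h > 0" "n \<ge> h"
    and "(word_power w h, word_power w (h + d)) \<in> congruence_generated X R"
  shows "(word_power w n, word_power w (n + k * d)) \<in> congruence_generated X R"
proof (induction k)
  case 0
  \<comment> \<open>That \<open>w\<close> is nonempty follows from the last assumption, which puts
    \<open>word_power w h\<close> into the free semigroup.\<close>
  have "word_power w n \<in> free_semigroup X"
    using assms word_power_free[of w X n]
      congruence_generated_free(1)[OF assms(4)] by (cases "w = []") (auto simp: free_semigroup_def word_power_def)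
  then show ?case by (simp add: congruence_generated.refl)
next
  case (Suc k)
  have "(word_power w h @ word_power w (n - h + k * d), word_power w (h + d) @ word_power w (n - h + k * d))
      \<in> congruence_generated X R"
    using assms by (intro congruence_generated_append_right set_word_power)
  then have "(word_power w (n + k * d), word_power w (n + Suc k * d)) \<in> congruence_generated X R"
    using assms(3) by (simp flip: word_power_add add: algebra_simps)
  with Suc show ?case by (rule congruence_generated.trans)
qed

text \<open>In the longer power with exponent h + (h + 1) d, at least h factors stand on either side
  of the factor number h (from 0). Its first letter is a seed by reflexivity alone, and
  \<open>seeded_cong\<close> carries seededness back to exponent h.\<close>

lemma seeded_word_power:
  assumes R: "one_sided_relations X R" and w: "w \<in> free_semigroup X"
    and hd: "h > 0" "d > 0"
    and per: "(word_power w h, word_power w (h + d)) \<in> congruence_generated X R"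
  shows "seeded X R (word_power w h) (word_power w h)"
proof -
  let ?C = "congruence_generated X R"
  have wX: "set w \<subseteq> X" using w by (simp add: free_semigroup_def)
  obtain e v where ev: "w = e # v"
    using w by (cases w) (auto simp: free_semigroup_def)
  \<comment> \<open>The number of factors between the seeded one and the final h factors: (h + 1) d
    = 1 + r + h.\<close>
  define r where "r = (d - 1) * (h + 1)"
  have "h + (h + 1) * d = h + (1 + (r + h))"
    using hd(2) by (cases d) (simp_all add: r_def)
  then have split: "word_power w (h + (h + 1) * d) =
      word_power w h @ e # v @ word_power w r @ word_power w h"
    using ev by (simp only: word_power_add) (simp add: word_power_def)
  have sub: "set (e # v @ word_power w r) \<subseteq> X"
    using wX ev set_word_power[OF wX, of r] by auto
  have free: "word_power w h @ x \<in> free_semigroup X" "x @ word_power w h \<in> free_semigroup X"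
    if "set x \<subseteq> X" for x
    using word_power_free[OF w hd(1)] that by (auto simp: free_semigroup_def)
  have "seeded X R (word_power w h) (word_power w (h + (h + 1) * d))"
    unfolding split
  proof (rule seededI)
    show "(word_power w h @ [e], word_power w h @ [e]) \<in> ?C"
      using sub by (intro congruence_generated.refl free) simp
    have "(e # v @ word_power w r) @ word_power w h \<in> free_semigroup X"
      using sub by (rule free)
    then show "(e # v @ word_power w r @ word_power w h,
        (e # v @ word_power w r) @ word_power w h) \<in> ?C"
      using congruence_generated.refl by fastforce
  qed (use sub in auto)
  then show ?thesis
    using seeded_cong[OF R word_power_period[OF wX hd(1) order.refl per, of "h + 1"], of "[]" "[]"]
    by simp
qed

lemma word_power_period_descend:
  assumes R: "one_sided_relations X R" and w: "w \<in> free_semigroup X"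
    and hd: "h > 0" "d > 0"
    and per: "(word_power w (Suc h), word_power w (Suc h + d)) \<in> congruence_generated X R"
  shows "(word_power w h, word_power w (h + d)) \<in> congruence_generated X R"
proof -
  let ?C = "congruence_generated X R" and ?p = "word_power w"
  have wX: "set w \<subseteq> X" using w by (simp add: free_semigroup_def)
  have "seeded X R (?p (Suc h)) (?p (Suc h))"
    using R w _ hd(2) per by (rule seeded_word_power) simp
  then obtain x e y t t' where eq: "?p (Suc h) = x @ e # y"
    and t: "set t \<subseteq> X" "(x @ [e], ?p (Suc h) @ t) \<in> ?C"
    and t': "set t' \<subseteq> X" "(e # y, t' @ ?p (Suc h)) \<in> ?C"
    unfolding seeded_def by blast
  obtain k w' w'' where k: "k < Suc h" and ww: "w = w' @ e # w''"
    and x: "x = ?p k @ w'" and y: "y = w'' @ ?p (Suc h - Suc k)"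
    using eq by (rule word_power_eq_append_Cons)
  have w'X: "set w' \<subseteq> X" "set w'' \<subseteq> X" using ww wX by auto
  show ?thesis
  \<comment> \<open>If k < h, the seed avoids the last factor, so \<open>x @ [e]\<close> is a prefix
    of the power with exponent h.\<close>
  proof (cases "k < h")
    case True
    have px: "set (w'' @ ?p (h - Suc k)) \<subseteq> X"
      using w'X set_word_power[OF wX] by auto
    have "h = k + (1 + (h - Suc k))" using True by simp
    then have "?p h = ?p k @ w @ ?p (h - Suc k)"
      by (metis word_power_add plus_1_eq_Suc word_power_simps(2))
    then have ph: "?p h = (x @ [e]) @ (w'' @ ?p (h - Suc k))"
      unfolding x ww by simp
    \<comment> \<open>With a the class of \<open>w\<close>, this is a^h = a^(h+1) z. Multiplying by
      a^d on the left gives a^(h+d) = a^(h+1+d) z = a^(h+1) z = a^h.\<close>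
    obtain z where z: "set z \<subseteq> X" "(?p h, ?p (Suc h) @ z) \<in> ?C"
    proof
      show "(?p h, ?p (Suc h) @ t @ w'' @ ?p (h - Suc k)) \<in> ?C"
        unfolding ph using congruence_generated_append_right[OF t(2) px] by simp
      show "set (t @ w'' @ ?p (h - Suc k)) \<subseteq> X" using t px by auto
    qed
    have "(?p d @ ?p h, ?p d @ ?p (Suc h) @ z) \<in> ?C"
      using z(2) set_word_power[OF wX] by (rule congruence_generated_append_left)
    then have "(?p (h + d), ?p (Suc h + d) @ z) \<in> ?C"
      by (metis word_power_add append.assoc add.commute)
    moreover have "(?p (Suc h) @ z, ?p (Suc h + d) @ z) \<in> ?C"
      using per z(1) by (rule congruence_generated_append_right)
    ultimately show ?thesis
      using z(2) by (meson congruence_generated.sym congruence_generated.trans)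
  next
    case False
    then have "k = h" using k by simp
    \<comment> \<open>The seed lies in the last factor, so \<open>y = w''\<close>. As h > 0, the
      power with exponent h still ends in a factor \<open>w\<close>, hence in \<open>e # y\<close>,
      and the dual argument applies.\<close>
    obtain j where j: "h = Suc j" using hd(1) by (cases h) auto
    have px: "set (?p j @ w') \<subseteq> X"
      using w'X set_word_power[OF wX] by auto
    have "?p h = ?p j @ w"
      using word_power_add[of w j 1] j by simp
    then have ph: "?p h = (?p j @ w') @ (e # y)"
      using ww y \<open>k = h\<close> by simp
    obtain z where z: "set z \<subseteq> X" "(?p h, z @ ?p (Suc h)) \<in> ?C"
    proof
      show "(?p h, (?p j @ w' @ t') @ ?p (Suc h)) \<in> ?C"
        unfolding ph using congruence_generated_append_left[OF t'(2) px] by simp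
      show "set (?p j @ w' @ t') \<subseteq> X" using t' px by auto
    qed
    have "(?p h @ ?p d, (z @ ?p (Suc h)) @ ?p d) \<in> ?C"
      using z(2) set_word_power[OF wX] by (rule congruence_generated_append_right)
    then have "(?p (h + d), z @ ?p (Suc h + d)) \<in> ?C"
      by (metis word_power_add append.assoc)
    moreover have "(z @ ?p (Suc h), z @ ?p (Suc h + d)) \<in> ?C"
      using per z(1) by (rule congruence_generated_append_left)
    ultimately show ?thesis
      using z(2) by (meson congruence_generated.sym congruence_generated.trans)
  qed
qed

lemma word_power_period_one:
  assumes R: "one_sided_relations X R" and w: "w \<in> free_semigroup X" and d: "d > 0"
    and "(word_power w (Suc h), word_power w (Suc h + d)) \<in> congruence_generated X R"
  shows "(w, word_power w (1 + d)) \<in> congruence_generated X R"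
  using assms(4)
proof (induction h)
  case (Suc h)
  have "(word_power w (Suc h), word_power w (Suc h + d)) \<in> congruence_generated X R"
    using R w _ d Suc.prems by (rule word_power_period_descend) simp
  then show ?case by (rule Suc.IH)
qed simp

section \<open>From periodic elements to groups of powers\<close>

lemma presented_powers:
  assumes "w \<in> free_semigroup X"
  shows "(presented_mult X R (congruence_generated X R `` {w}) ^^ n)
      (congruence_generated X R `` {w}) = congruence_generated X R `` {word_power w (Suc n)}"
proof (induction n)
  case (Suc n)
  then show ?case
    using presented_mult_class[OF assms word_power_free[OF assms, of "Suc n"]] by simp
qed simp

text \<open>Pigeonhole on the exponents. They are successors because the power with exponent 0 is
  the empty word.\<close>

lemma presented_periodicE:
  assumes w: "w \<in> free_semigroup X"
    and "periodic (presented_carrier X R) (presented_mult X R) (congruence_generated X R `` {w})"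
  obtains h d where "d > 0"
    "(word_power w (Suc h), word_power w (Suc h + d)) \<in> congruence_generated X R"
proof -
  let ?C = "congruence_generated X R"
  let ?q = "\<lambda>n. ?C `` {word_power w (Suc n)}"
  have "finite (range ?q)"
    using assms(2) subsemigroup_generated_powers[OF presented_semigroup, of "?C `` {w}" X R]
    by (simp add: periodic_def presented_powers[OF w])
  then have "\<not> inj ?q" using finite_imageD infinite_UNIV_nat by blast
  then obtain i j where ij: "i < j" "?q i = ?q j"
    unfolding inj_def by (metis nat_neq_iff)
  have "(word_power w (Suc i), word_power w (Suc j)) \<in> ?C"
    using ij(2) congruence_generated_equiv word_power_free[OF w] eq_equiv_class by (metis zero_less_Suc)
  then show ?thesis
    using that[of "j - i" i] ij(1) by simp
qed

text \<open>By a = a^(1+d), a power of a depends only on its positive exponent modulo d, so a^d is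
  the identity. The period d need not be minimal.\<close>

lemma presented_powers_group:
  assumes w: "w \<in> free_semigroup X" and d: "d > 0"
    and per: "(w, word_power w (1 + d)) \<in> congruence_generated X R"
  shows "subgroup_of_semigroup (presented_carrier X R) (presented_mult X R)
    (range (\<lambda>n. congruence_generated X R `` {word_power w (Suc n)}))"
proof -
  let ?C = "congruence_generated X R" and ?m = "presented_mult X R"
  define q where "q n = ?C `` {word_power w n}" for n
  have wX: "set w \<subseteq> X" using w by (simp add: free_semigroup_def)
  have H: "range (\<lambda>n. ?C `` {word_power w (Suc n)}) = q ` {0<..}"
    unfolding q_def by (force simp: image_iff gr0_conv_Suc)
  have mult: "?m (q i) (q j) = q (i + j)" if "i > 0" "j > 0" for i j
    unfolding q_def word_power_add using that by (simp add: presented_mult_class word_power_free[OF w])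
  have shift: "q (n + k * d) = q n" if "n > 0" for n k
  proof -
    have "(word_power w n, word_power w (n + k * d)) \<in> ?C"
      using per that by (intro word_power_period[OF wX, of 1]) auto
    then show ?thesis
      unfolding q_def using equiv_class_eq[OF congruence_generated_equiv] by metis
  qed
  have "subsemigroup (presented_carrier X R) ?m (q ` {0<..})"
    unfolding subsemigroup_def presented_carrier_def
    using mult word_power_free[OF w] by (auto simp: q_def intro!: quotientI)
  moreover have "group \<lparr>carrier = q ` {0<..}, mult = ?m, one = q d\<rparr>"
  proof (rule groupI, unfold partial_object.select_convs monoid.select_convs)
    show "q d \<in> q ` {0<..}" using d by simp
    show "?m x y \<in> q ` {0<..}" if "x \<in> q ` {0<..}" "y \<in> q ` {0<..}" for x y
      using that mult by auto
    show "?m (?m x y) z = ?m x (?m y z)"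
      if "x \<in> q ` {0<..}" "y \<in> q ` {0<..}" "z \<in> q ` {0<..}" for x y z
      using that mult by (auto simp: add.assoc)
    show "?m (q d) x = x" if "x \<in> q ` {0<..}" for x
      using that mult d shift[of _ 1] by (auto simp: add.commute)
    show "\<exists>y\<in>q ` {0<..}. ?m y x = q d" if "x \<in> q ` {0<..}" for x
    proof -
      obtain n where n: "x = q n" "n > 0" using \<open>x \<in> q ` {0<..}\<close> by auto
      obtain c where c: "d = Suc c" using d by (cases d) auto
      \<comment> \<open>The inverse of a^n is a^(n (2 d - 1)), since the exponents add up to 2 n d.
        The more obvious n (d - 1) would be 0 for d = 1.\<close>
      have "n * (c + d) + n = d + (2 * n - 1) * d"
        using n(2) by (cases n) (auto simp: c algebra_simps)
      then have "?m (q (n * (c + d))) x = q d"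
        using n d mult shift[of d "2 * n - 1"] by simp
      then show ?thesis using n(2) d by (intro bexI[of _ "q (n * (c + d))"]) auto
    qed
  qed
  ultimately show ?thesis
    unfolding H subgroup_of_semigroup_def by blast
qed

theorem presented_periodic_in_subgroup:
  assumes "one_sided_relations X R"
    and "periodic (presented_carrier X R) (presented_mult X R) a"
  shows "\<exists>H. subgroup_of_semigroup (presented_carrier X R) (presented_mult X R) H \<and> a \<in> H"
proof -
  from assms(2) obtain w where w: "w \<in> free_semigroup X" "a = congruence_generated X R `` {w}"
    by (auto simp: periodic_def presented_carrier_def elim: quotientE)
  obtain h d where hd: "d > 0"
    "(word_power w (Suc h), word_power w (Suc h + d)) \<in> congruence_generated X R"
    using presented_periodicE[OF w(1)] assms(2) w(2) by blast
  have "(w, word_power w (1 + d)) \<in> congruence_generated X R"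
    using assms(1) w(1) hd by (rule word_power_period_one)
  with w(1) hd(1) have "subgroup_of_semigroup (presented_carrier X R) (presented_mult X R)
      (range (\<lambda>n. congruence_generated X R `` {word_power w (Suc n)}))"
    by (rule presented_powers_group)
  then show ?thesis
  proof (intro exI conjI)
    show "a \<in> range (\<lambda>n. congruence_generated X R `` {word_power w (Suc n)})"
      using w(2) by (intro range_eqI[of _ _ 0]) simp
  qed
qed

section \<open>One-sidedness of the relations of a biordered set\<close>

lemma biordered_set_one_sided:
  assumes bio: "biordered_set TYPE('s) E p"
    and ef: "e \<in> E" "f \<in> E" "p e f = Some g"
  shows "p g e = Some e \<or> p f g = Some f"
proof -
  from bio obtain S :: "'s set" and m \<phi> where S: "semigroup_on S m"
    and iso: "partial_groupoid_iso E p (idempotents S m) (basic_product m) \<phi>"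
    and pg: "partial_groupoid E p"
    unfolding biordered_set_def by blast
  have g: "g \<in> E" using pg ef unfolding partial_groupoid_def by blast
  have inj: "inj_on \<phi> E" and img: "\<phi> ` E = idempotents S m"
    using iso by (auto simp: partial_groupoid_iso_def bij_betw_def)
  have idem: "m (\<phi> x) (\<phi> x) = \<phi> x" "\<phi> x \<in> S" if "x \<in> E" for x
    using that img by (auto simp: idempotents_def)
  have assoc: "m (m x y) z = m x (m y z)" if "x \<in> S" "y \<in> S" "z \<in> S" for x y z
    using S that by (auto simp: semigroup_on_def)
  have bp: "basic_product m (\<phi> x) (\<phi> y) = map_option \<phi> (p x y)" if "x \<in> E" "y \<in> E" for x y
    using iso that by (auto simp: partial_groupoid_iso_def)
  \<comment> \<open>This and \<open>p'\<close> pull a product equal to one of its factors back from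
    the witnessing semigroup to E, by injectivity of \<open>\<phi>\<close>.\<close>
  have p: "p x y = Some x"
    if xy: "x \<in> E" "y \<in> E" and eq: "basic_product m (\<phi> x) (\<phi> y) = Some (\<phi> x)" for x y
  proof -
    obtain z where z: "p x y = Some z" "\<phi> z = \<phi> x"
      using bp[OF xy] eq by (metis map_option_eq_Some)
    moreover have "z \<in> E" using pg xy z(1) unfolding partial_groupoid_def by blast
    ultimately show ?thesis using inj xy by (auto dest: inj_onD)
  qed
  have p': "p x y = Some y"
    if xy: "x \<in> E" "y \<in> E" and eq: "basic_product m (\<phi> x) (\<phi> y) = Some (\<phi> y)" for x y
  proof -
    obtain z where z: "p x y = Some z" "\<phi> z = \<phi> y"
      using bp[OF xy] eq by (metis map_option_eq_Some)
    moreover have "z \<in> E" using pg xy z(1) unfolding partial_groupoid_def by blast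
    ultimately show ?thesis using inj xy by (auto dest: inj_onD)
  qed
  have bpg: "basic_product m (\<phi> e) (\<phi> f) = Some (\<phi> g)"
    using bp[OF ef(1,2)] ef(3) by simp
  then have gm: "\<phi> g = m (\<phi> e) (\<phi> f)"
    and cases: "\<phi> g = \<phi> e \<or> \<phi> g = \<phi> f \<or> m (\<phi> f) (\<phi> e) = \<phi> e \<or> m (\<phi> f) (\<phi> e) = \<phi> f"
    by (auto simp: basic_product_def split: if_splits)
  have left: "m (\<phi> e) (\<phi> g) = \<phi> g" and right: "m (\<phi> g) (\<phi> f) = \<phi> g"
    unfolding gm using assoc idem ef by metis+
  have ge: "m (\<phi> g) (\<phi> e) = m (\<phi> e) (m (\<phi> f) (\<phi> e))"
    and fg: "m (\<phi> f) (\<phi> g) = m (m (\<phi> f) (\<phi> e)) (\<phi> f)"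
    unfolding gm using assoc idem ef by metis+
  \<comment> \<open>Omitting \<open>\<phi>\<close>, with g = e f: if g = e or f e = e, then g e = e
    f e = e; if g = f or f e = f, then f g = f e f = f.\<close>
  from cases consider "m (\<phi> g) (\<phi> e) = \<phi> e" | "m (\<phi> f) (\<phi> g) = \<phi> f"
    using ge fg idem ef by metis
  then show ?thesis
  proof cases
    case 1
    then have "basic_product m (\<phi> g) (\<phi> e) = Some (\<phi> e)"
      by (simp add: basic_product_def)
    then show ?thesis using p'[OF g ef(1)] by simp
  next
    case 2
    then have "basic_product m (\<phi> f) (\<phi> g) = Some (\<phi> f)"
      by (simp add: basic_product_def)
    then show ?thesis using p[OF ef(2) g] by simp
  qed
qed

text \<open>The products supplied by \<open>biordered_set_one_sided\<close> are themselves defining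
  relations, g e = e or f g = f, here read from right to left.\<close>

lemma IG_one_sided:
  assumes "biordered_set TYPE('s) E p"
  shows "one_sided_relations E (IG_relations E p)"
proof -
  have g: "g \<in> E" if "e \<in> E" "f \<in> E" "p e f = Some g" for e f g
    using assms that unfolding biordered_set_def partial_groupoid_def by blast
  have rel: "([x], [e, f]) \<in> congruence_generated E (IG_relations E p)"
    if "e \<in> E" "f \<in> E" "p e f = Some x" for e f x
  proof (rule congruence_generated.sym, rule congruence_generated.base)
    show "([e, f], [x]) \<in> IG_relations E p"
      using that unfolding IG_relations_def by blast
    show "[e, f] \<in> free_semigroup E" "[x] \<in> free_semigroup E"
      using that g[OF that] by (simp_all add: free_semigroup_def)
  qed
  have side: "([e], [g, e]) \<in> congruence_generated E (IG_relations E p) \<or>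
      ([f], [f, g]) \<in> congruence_generated E (IG_relations E p)"
    if "e \<in> E" "f \<in> E" "p e f = Some g" for e f g
    using biordered_set_one_sided[OF assms that]
  proof
    assume "p g e = Some e"
    then show ?thesis using rel[OF g[OF that] that(1)] by simp
  next
    assume "p f g = Some f"
    then show ?thesis using rel[OF that(2) g[OF that]] by simp
  qed
  show ?thesis
    unfolding one_sided_relations_def
  proof (clarify, goal_cases)
    case (1 u v)
    then obtain e f g where "u = [e, f]" "v = [g]" "e \<in> E" "f \<in> E" "p e f = Some g"
      unfolding IG_relations_def by blast
    with side show ?case by blast
  qed
qed

theorem mainTheorem1:
  fixes E :: "'e set" and p :: "'e \<Rightarrow> 'e \<Rightarrow> 'e option" and a :: "'e list set"
  assumes "biordered_set TYPE('s) E p"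
    and "a \<in> IG_carrier E p"
    and "periodic (IG_carrier E p) (IG_mult E p) a"
  shows "\<exists>H. subgroup_of_semigroup (IG_carrier E p) (IG_mult E p) H \<and> a \<in> H"
  using presented_periodic_in_subgroup[OF IG_one_sided[OF assms(1)]] assms(3)
  unfolding IG_carrier_def IG_mult_def by blast

end
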